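(* Let $\lambda:[0,\infty)\to[0,\infty)$ be continuous with $\int_0^t\lambda(s)\,ds<\infty$ for all $t\ge0$, let $X$ be a real random variable, let $M(t)=\sum_{k=1}^{N(t)}X_k$ be a compound Poisson process $M\sim CP(\lambda,X)$, and let $\alpha\ge0$. For $t>0$ (with $\int_0^t\lambda(u)\,du>0$) let $\Lambda_t$ be a random variable with $$P\{\Lambda_t\in ds\}=\frac{\lambda(s)\,ds}{\int_0^t\lambda(u)\,du},\quad s\in[0,t].$$ Then, under Condition II below, for each fixed $t$, $$\int_0^t(t-s)^\alpha M(s)\,ds\ \stackrel{d}{=}\ \sum_{k=1}^{N(t)}X_k\,\frac{(t-\Lambda_{t,k})^{\alpha+1}}{\alpha+1},$$ where $\Lambda_{t,1},\Lambda_{t,2},\dots$ are independent copies of $\Lambda_t$, independent of $N$ and of $X_1,X_2,\dots$. (For $t=0$ both sides are $0$.)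
   Context: $M\sim CP(\lambda,X)$ means $M(t)=\sum_{k=1}^{N(t)}X_k$, $t\ge0$, with $N$ a (non-homogeneous) Poisson process with rate function $\lambda$ and $X_1,X_2,\dots$ i.i.d. copies of $X$, independent of $N$. The symbol $\stackrel{d}{=}$ denotes equality in distribution of random variables. Condition II (standing assumption, for an integral $\int_0^t Z_{N(s)}f(s)\,ds$ with $Z=\{Z_n\}_{n\ge 0}$ a discrete real process, here $Z_n=\sum_{k=1}^nX_k$, and $f$ integrable, here $f(s)=(t-s)^\alpha$): if $Z$ is a bounded process, or $Z_n\ge0\ (\le0)$ for all $n$ a.s. and $f\ge0\ (\le0)$, then $N$ is allowed to explode in finite time intervals; otherwise $N$ is assumed not to explode in finite intervals. *)

theory Defs
  imports "HOL-Probability.Probability"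
begin

(* Equality in distribution of real random variables, possibly on different spaces.
   Measurability is part of the definition because distr is not meaningful without it. *)
definition eq_in_distr ::
  "'a measure \<Rightarrow> ('a \<Rightarrow> real) \<Rightarrow> 'b measure \<Rightarrow> ('b \<Rightarrow> real) \<Rightarrow> bool" where
  "eq_in_distr P X Q Y \<longleftrightarrow>
     X \<in> borel_measurable P \<and> Y \<in> borel_measurable Q \<and> distr P borel X = distr Q borel Y"

(* All sequences of copies are indexed by k = 1, 2, ... *)
definition iid_copies ::
  "'a measure \<Rightarrow> (nat \<Rightarrow> 'a \<Rightarrow> real) \<Rightarrow> 'b measure \<Rightarrow> ('b \<Rightarrow> real) \<Rightarrow> bool" where
  "iid_copies P X Q X0 \<longleftrightarrow>
     prob_space.indep_vars P (\<lambda>_. borel) X {1..} \<and> (\<forall>k\<ge>1. eq_in_distr P (X k) Q X0)"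

definition rate_function :: "(real \<Rightarrow> real) \<Rightarrow> bool" where
  "rate_function rate \<longleftrightarrow>
     continuous_on {0..} rate \<and> (\<forall>s\<ge>0. 0 \<le> rate s) \<and>
     (\<forall>t\<ge>0. set_integrable lborel {0..t} rate)"

(* Non-homogeneous Poisson process. Paths are nat-valued, so they do not explode; for a
   locally integrable rate every Poisson process is almost surely of this kind.
   The increment law is written out because the mean may be 0 (with 0 ^ 0 = 1),
   while poisson_pmf requires a positive parameter. *)
definition poisson_process ::
  "'a measure \<Rightarrow> (real \<Rightarrow> real) \<Rightarrow> (real \<Rightarrow> 'a \<Rightarrow> nat) \<Rightarrow> bool" where
  "poisson_process P rate N \<longleftrightarrow>
     (\<forall>t\<ge>0. N t \<in> measurable P (count_space UNIV)) \<and>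
     (\<forall>\<omega>\<in>space P. N 0 \<omega> = 0 \<and> mono_on {0..} (\<lambda>t. N t \<omega>) \<and>
        (\<forall>t\<ge>0. continuous (at_right t) (\<lambda>s. N s \<omega>))) \<and>
     (\<forall>(n::nat) (\<tau>::nat \<Rightarrow> real). 0 \<le> \<tau> 0 \<and> mono_on {..n} \<tau> \<longrightarrow>
        prob_space.indep_vars P (\<lambda>_. count_space UNIV)
          (\<lambda>i \<omega>. N (\<tau> (Suc i)) \<omega> - N (\<tau> i) \<omega>) {..<n}) \<and>
     (\<forall>s t k. 0 \<le> s \<and> s \<le> t \<longrightarrow>
        measure P {\<omega> \<in> space P. N t \<omega> - N s \<omega> = k} =
          (LINT u:{s..t}|lborel. rate u) ^ k / fact k * exp (- (LINT u:{s..t}|lborel. rate u)))"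

(* The whole paths / sequences as random elements of product spaces. *)
abbreviation process_space :: "(real \<Rightarrow> nat) measure" where
  "process_space \<equiv> PiM {0..} (\<lambda>_. count_space UNIV)"

abbreviation process_path :: "(real \<Rightarrow> 'a \<Rightarrow> nat) \<Rightarrow> 'a \<Rightarrow> real \<Rightarrow> nat" where
  "process_path N \<equiv> (\<lambda>\<omega>. \<lambda>t\<in>{0..}. N t \<omega>)"

abbreviation seq_space :: "(nat \<Rightarrow> real) measure" where
  "seq_space \<equiv> PiM {1..} (\<lambda>_. borel)"

abbreviation seq_path :: "(nat \<Rightarrow> 'a \<Rightarrow> real) \<Rightarrow> 'a \<Rightarrow> nat \<Rightarrow> real" where
  "seq_path X \<equiv> (\<lambda>\<omega>. \<lambda>k\<in>{1..}. X k \<omega>)"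

(* The library's indep_var forces both variables to have the same value type; this is the same
   notion (independence of the generated sigma-algebras) for different value types. *)
definition indep_elements ::
  "'a measure \<Rightarrow> 'b measure \<Rightarrow> ('a \<Rightarrow> 'b) \<Rightarrow> 'c measure \<Rightarrow> ('a \<Rightarrow> 'c) \<Rightarrow> bool" where
  "indep_elements P S f T g \<longleftrightarrow>
     f \<in> measurable P S \<and> g \<in> measurable P T \<and>
     prob_space.indep_set P
       {f -` A \<inter> space P | A. A \<in> sets S} {g -` B \<inter> space P | B. B \<in> sets T}"

(* M ~ CP(rate, X0), where X0 is a random variable on Q; N and X are the Poisson process and
   the jump sequence that represent M. *)
definition compound_poisson ::
  "'a measure \<Rightarrow> (real \<Rightarrow> real) \<Rightarrow> 'b measure \<Rightarrow> ('b \<Rightarrow> real) \<Rightarrow>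
     (real \<Rightarrow> 'a \<Rightarrow> nat) \<Rightarrow> (nat \<Rightarrow> 'a \<Rightarrow> real) \<Rightarrow> (real \<Rightarrow> 'a \<Rightarrow> real) \<Rightarrow> bool" where
  "compound_poisson P rate Q X0 N X M \<longleftrightarrow>
     poisson_process P rate N \<and> iid_copies P X Q X0 \<and>
     indep_elements P process_space (process_path N) seq_space (seq_path X) \<and>
     (\<forall>t\<ge>0. \<forall>\<omega>\<in>space P. M t \<omega> = (\<Sum>k=1..N t \<omega>. X k \<omega>))"

end

theory Submission
  imports Defs
begin

text \<open>
  Write \<open>g(s) = (t - s)\<^sup>\<alpha>\<^sup>+\<^sup>1 / (\<alpha> + 1)\<close> and let \<open>\<phi>\<close> be the characteristic function of \<open>X\<close>. Both sides
  have characteristic function \<open>u \<mapsto> exp (\<integral>\<^sub>0\<^sup>t \<lambda>(s) (\<phi>(u g(s)) - 1) ds)\<close>. On the right this follows by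
  conditioning on \<open>N\<close> and \<open>X\<close>. On the left no arrival times are needed: replacing \<open>M(s)\<close> by its value
  at the next point of the grid \<open>t i / n\<close> turns the integral, after summation by parts, into
  \<open>\<Sum>\<^sub>i g(t i / n) (M(t (i+1) / n) - M(t i / n))\<close>. Its characteristic function is explicit because
  the increments of \<open>N\<close> are independent, and it converges pointwise to the integral
  because the paths are right-continuous.
\<close>

section \<open>Expectations of independent elements, of i.i.d. products and of Poisson
  powers\<close>

text \<open>Independence of the generated sigma-algebras is the product formula on rectangles
  \<open>A \<times> B\<close>, and rectangles determine the product of two sigma-finite
  laws.\<close>

lemma indep_elements_distr_pair:
  assumes "prob_space P" "indep_elements P S f T g"
  shows "distr P (S \<Otimes>\<^sub>M T) (\<lambda>\<omega>. (f \<omega>, g \<omega>)) = distr P S f \<Otimes>\<^sub>M distr P T g"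
proof -
  interpret prob_space P by fact
  have [measurable]: "f \<in> measurable P S" "g \<in> measurable P T"
    and indep: "indep_set {f -` A \<inter> space P | A. A \<in> sets S} {g -` B \<inter> space P | B. B \<in> sets T}"
    using assms(2) by (auto simp: indep_elements_def)
  interpret F: prob_space "distr P S f" by (rule prob_space_distr) simp
  interpret G: prob_space "distr P T g" by (rule prob_space_distr) simp
  have "distr P S f \<Otimes>\<^sub>M distr P T g = distr P (S \<Otimes>\<^sub>M T) (\<lambda>\<omega>. (f \<omega>, g \<omega>))"
  proof (rule pair_measure_eqI)
    fix A B assume "A \<in> sets (distr P S f)" "B \<in> sets (distr P T g)"
    then have [measurable]: "A \<in> sets S" "B \<in> sets T" by auto
    have "prob ((f -` A \<inter> space P) \<inter> (g -` B \<inter> space P))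
        = prob (f -` A \<inter> space P) * prob (g -` B \<inter> space P)"
      by (rule indep_setD[OF indep]) auto
    moreover have "(\<lambda>\<omega>. (f \<omega>, g \<omega>)) -` (A \<times> B) \<inter> space P
        = (f -` A \<inter> space P) \<inter> (g -` B \<inter> space P)"
      by auto
    ultimately show "emeasure (distr P S f) A * emeasure (distr P T g) B
        = emeasure (distr P (S \<Otimes>\<^sub>M T) (\<lambda>\<omega>. (f \<omega>, g \<omega>))) (A \<times> B)"
      by (simp add: emeasure_distr emeasure_eq_measure ennreal_mult)
  qed (auto intro: F.sigma_finite_measure_axioms G.sigma_finite_measure_axioms)
  then show ?thesis by simp
qed

text \<open>This is the form in which conditioning is used: \<open>f\<close> is frozen at \<omega>
  while \<open>g\<close> is averaged over its own variable \<omega>'. Boundedness of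
  \<open>h\<close> makes Fubini applicable to the joint law.\<close>

lemma indep_elements_integral:
  fixes h :: "'b \<times> 'c \<Rightarrow> 'd::{banach, second_countable_topology}"
  assumes "prob_space P" "indep_elements P S f T g"
    and [measurable]: "h \<in> borel_measurable (S \<Otimes>\<^sub>M T)"
    and bound: "\<And>z. norm (h z) \<le> B"
  shows "(\<integral>\<omega>. h (f \<omega>, g \<omega>) \<partial>P) = (\<integral>\<omega>. \<integral>\<omega>'. h (f \<omega>, g \<omega>') \<partial>P \<partial>P)"
proof -
  interpret prob_space P by fact
  have [measurable]: "f \<in> measurable P S" "g \<in> measurable P T"
    using assms(2) by (auto simp: indep_elements_def)
  interpret F: prob_space "distr P S f" by (rule prob_space_distr) simp
  interpret G: prob_space "distr P T g" by (rule prob_space_distr) simp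
  interpret FG: pair_prob_space "distr P S f" "distr P T g" ..
  have int: "integrable (distr P S f \<Otimes>\<^sub>M distr P T g) h"
    by (rule FG.integrable_const_bound[where B=B]) (simp_all add: bound)
  have "(\<integral>\<omega>. h (f \<omega>, g \<omega>) \<partial>P) = integral\<^sup>L (distr P (S \<Otimes>\<^sub>M T) (\<lambda>\<omega>. (f \<omega>, g \<omega>))) h"
    by (simp add: integral_distr)
  also have "\<dots> = (\<integral>x. \<integral>y. h (x, y) \<partial>distr P T g \<partial>distr P S f)"
    unfolding indep_elements_distr_pair[OF assms(1,2)] FG.integral_fst'[OF int] ..
  also have "\<dots> = (\<integral>\<omega>. \<integral>y. h (f \<omega>, y) \<partial>distr P T g \<partial>P)"
    by (rule integral_distr) simp_all
  also have "\<dots> = (\<integral>\<omega>. \<integral>\<omega>'. h (f \<omega>, g \<omega>') \<partial>P \<partial>P)"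
    by (intro Bochner_Integration.integral_cong refl integral_distr) (simp_all)
  finally show ?thesis .
qed

lemma integral_eq_in_distr:
  fixes h :: "real \<Rightarrow> 'd::{banach, second_countable_topology}"
  assumes "eq_in_distr P X Q Y" "h \<in> borel_measurable borel"
  shows "(\<integral>\<omega>. h (X \<omega>) \<partial>P) = (\<integral>\<omega>. h (Y \<omega>) \<partial>Q)"
  using assms integral_distr[of X P borel h] integral_distr[of Y Q borel h]
  by (simp add: eq_in_distr_def)

text \<open>The factor \<open>f k\<close> depends on \<open>k\<close> because, after conditioning,
  every copy carries its own coefficient. The common bound makes all factors integrable.\<close>

lemma iid_copies_integral_prod:
  fixes f :: "nat \<Rightarrow> real \<Rightarrow> complex"
  assumes "prob_space P" "iid_copies P Y Q Y0"
    and [measurable]: "\<And>k. f k \<in> borel_measurable borel"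
    and bound: "\<And>k x. norm (f k x) \<le> B"
  shows "(\<integral>\<omega>. (\<Prod>k=1..m::nat. f k (Y k \<omega>)) \<partial>P) = (\<Prod>k=1..m. \<integral>\<omega>. f k (Y0 \<omega>) \<partial>Q)"
proof -
  interpret prob_space P by fact
  have indep: "indep_vars (\<lambda>_. borel) Y {1..}" and eq: "\<And>k. k \<ge> 1 \<Longrightarrow> eq_in_distr P (Y k) Q Y0"
    using assms(2) by (auto simp: iid_copies_def)
  have [measurable]: "Y k \<in> borel_measurable P" if "k \<ge> 1" for k
    using eq[OF that] by (simp add: eq_in_distr_def)
  have "(\<integral>\<omega>. (\<Prod>k=1..m. f k (Y k \<omega>)) \<partial>P) = (\<Prod>k=1..m. \<integral>\<omega>. f k (Y k \<omega>) \<partial>P)"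
  proof (rule indep_vars_lebesgue_integral)
    show "indep_vars (\<lambda>_. borel) (\<lambda>k \<omega>. f k (Y k \<omega>)) {1..m}"
      by (rule indep_vars_compose2[OF indep_vars_subset[OF indep]]) auto
    show "integrable P (\<lambda>\<omega>. f k (Y k \<omega>))" if "k \<in> {1..m}" for k
      using that by (intro integrable_const_bound[where B=B]) (auto simp: bound)
  qed simp
  also have "\<dots> = (\<Prod>k=1..m. \<integral>\<omega>. f k (Y0 \<omega>) \<partial>Q)"
    by (intro prod.cong refl integral_eq_in_distr eq) auto
  finally show ?thesis .
qed

text \<open>The generating function of a Poisson variable on the closed unit disc, from the point
  probabilities so that \<mu> = 0 is covered. Truncating \<open>z ^ K\<close> to
  \<open>K < n\<close> gives a finite sum of indicators, whose expectation is a partial sum of the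
  exponential series; dominated convergence removes the truncation.\<close>

lemma poisson_integral_power:
  fixes K :: "'a \<Rightarrow> nat" and z :: complex
  assumes "prob_space P" and [measurable]: "K \<in> measurable P (count_space UNIV)"
    and pmf: "\<And>k. measure P {\<omega> \<in> space P. K \<omega> = k} = \<mu> ^ k / fact k * exp (- \<mu>)"
    and z: "norm z \<le> 1"
  shows "(\<integral>\<omega>. z ^ K \<omega> \<partial>P) = exp (of_real \<mu> * (z - 1))"
proof (rule LIMSEQ_unique)
  interpret prob_space P by fact
  let ?A = "\<lambda>k. {\<omega> \<in> space P. K \<omega> = k}"
  let ?s = "\<lambda>n \<omega>. \<Sum>k<n. indicat_real (?A k) \<omega> *\<^sub>R z ^ k"
  have s: "?s n \<omega> = (if K \<omega> < n then z ^ K \<omega> else 0)" if "\<omega> \<in> space P" for n \<omega>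
  proof -
    have "?s n \<omega> = (\<Sum>k<n. if K \<omega> = k then z ^ k else 0)"
      using that by (intro sum.cong) (auto simp: indicator_def)
    then show ?thesis by (simp add: sum.delta)
  qed
  show "(\<lambda>n. \<integral>\<omega>. ?s n \<omega> \<partial>P) \<longlonglongrightarrow> (\<integral>\<omega>. z ^ K \<omega> \<partial>P)"
  proof (rule integral_dominated_convergence[where w="\<lambda>_. 1"])
    show "AE \<omega> in P. (\<lambda>n. ?s n \<omega>) \<longlonglongrightarrow> z ^ K \<omega>"
    proof (rule AE_I2)
      fix \<omega> assume "\<omega> \<in> space P"
      then show "(\<lambda>n. ?s n \<omega>) \<longlonglongrightarrow> z ^ K \<omega>"
        by (intro tendsto_eventually eventually_mono[OF eventually_gt_at_top[of "K \<omega>"]])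
           (simp only: s if_True)
    qed
    show "AE \<omega> in P. norm (?s n \<omega>) \<le> 1" for n
    proof (rule AE_I2)
      fix \<omega> assume "\<omega> \<in> space P"
      then show "norm (?s n \<omega>) \<le> 1"
        unfolding s[OF \<open>\<omega> \<in> space P\<close>] using z by (simp add: norm_power power_le_one)
    qed
  qed simp_all
  have "(\<lambda>n. \<Sum>k<n. of_real (\<mu> ^ k / fact k * exp (- \<mu>)) * z ^ k) \<longlonglongrightarrow> exp (of_real (- \<mu>)) * exp (of_real \<mu> * z)"
  proof -
    have "(\<lambda>k. exp (of_real (- \<mu>)) * ((of_real \<mu> * z) ^ k /\<^sub>R fact k)) sums (exp (of_real (- \<mu>)) * exp (of_real \<mu> * z))"
      by (intro sums_mult exp_converges)
    then show ?thesis
      unfolding sums_def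
      by (simp add: power_mult_distrib scaleR_conv_of_real exp_of_real[symmetric] field_simps)
  qed
  moreover have "(\<integral>\<omega>. ?s n \<omega> \<partial>P) = (\<Sum>k<n. of_real (\<mu> ^ k / fact k * exp (- \<mu>)) * z ^ k)" for n
  proof -
    have int: "integrable P (indicat_real (?A k))" for k
      by (intro integrable_real_indicator) (auto simp: emeasure_eq_measure)
    have "(\<integral>\<omega>. ?s n \<omega> \<partial>P) = (\<Sum>k<n. \<integral>\<omega>. indicat_real (?A k) \<omega> *\<^sub>R z ^ k \<partial>P)"
      by (intro Bochner_Integration.integral_sum integrable_scaleR_left int)
    also have "\<dots> = (\<Sum>k<n. measure P (?A k) *\<^sub>R z ^ k)"
      by (intro sum.cong refl, subst integral_scaleR_left) (auto intro: int)
    finally show ?thesis by (simp only: pmf scaleR_conv_of_real)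
  qed
  moreover have "exp (of_real (- \<mu>)) * exp (of_real \<mu> * z) = exp (of_real \<mu> * (z - 1))"
    by (simp add: exp_add[symmetric] algebra_simps)
  ultimately show "(\<lambda>n. \<integral>\<omega>. ?s n \<omega> \<partial>P) \<longlonglongrightarrow> exp (of_real \<mu> * (z - 1))"
    by simp
qed

subsection \<open>Uniform grids\<close>

text \<open>There are \<open>Suc n\<close> cells, so that no index leads to a division by
  zero.\<close>

definition grid :: "real \<Rightarrow> nat \<Rightarrow> nat \<Rightarrow> real" where
  "grid t n i = t * real i / real (Suc n)"

text \<open>Half-open cells are disjoint and fill \<open>{0<..t}\<close>, and they fit the
  increments of a right-continuous path.\<close>

abbreviation cell :: "real \<Rightarrow> nat \<Rightarrow> nat \<Rightarrow> real set" where
  "cell t n i \<equiv> {grid t n i<..grid t n (Suc i)}"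

lemma grid_0 [simp]: "grid t n 0 = 0"
  and grid_end [simp]: "grid t n (Suc n) = t"
  by (simp_all add: grid_def)

lemma grid_mono: "0 \<le> t \<Longrightarrow> i \<le> j \<Longrightarrow> grid t n i \<le> grid t n j"
  unfolding grid_def by (intro divide_right_mono mult_left_mono) auto

lemma grid_nonneg [simp]: "0 \<le> t \<Longrightarrow> 0 \<le> grid t n i"
  by (simp add: grid_def)

lemma grid_le: "0 \<le> t \<Longrightarrow> i \<le> Suc n \<Longrightarrow> grid t n i \<le> t"
  using grid_mono[of t i "Suc n" n] by simp

lemma cell_subset: "0 \<le> t \<Longrightarrow> i < Suc n \<Longrightarrow> cell t n i \<subseteq> {0<..t}"
  using grid_le[of t "Suc i" n] grid_nonneg[of t n i]
  by (auto simp del: grid_nonneg)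

text \<open>Stated for an arbitrary linear order because it serves both the cells in time and the
  blocks of jump indices cut out by the values of \<open>N\<close> along a grid.\<close>

lemma mono_Ioc_disjoint:
  fixes a :: "nat \<Rightarrow> 'b::linorder"
  assumes "mono a" "x \<in> {a i<..a (Suc i)}" "x \<in> {a j<..a (Suc j)}"
  shows "i = j"
proof (rule ccontr)
  assume "i \<noteq> j"
  then consider "Suc i \<le> j" | "Suc j \<le> i" by linarith
  then show False
    using assms(2,3) monoD[OF assms(1), of "Suc i" j] monoD[OF assms(1), of "Suc j" i]
    by cases auto
qed

lemma ex_cell:
  assumes "s \<in> {0<..t}"
  shows "\<exists>i<Suc n. s \<in> cell t n i"
proof -
  have s: "0 < s" "s \<le> t" "0 < t" using assms by auto
  define P where "P i \<longleftrightarrow> s \<le> grid t n i" for i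
  have "P (Suc n)" using s by (simp add: P_def)
  \<comment> \<open>The first grid point that is not to the left of \<open>s\<close> is the right
    end of the cell containing \<open>s\<close>. It has a predecessor because
    \<open>s > 0\<close>.\<close>
  define j where "j = (LEAST i. P i)"
  have j: "P j" "j \<le> Suc n"
    unfolding j_def using \<open>P (Suc n)\<close> by (auto intro: LeastI Least_le)
  have "j \<noteq> 0"
  proof
    assume "j = 0"
    then show False using j(1) s(1) by (simp add: P_def)
  qed
  then obtain i where i: "j = Suc i" by (cases j) auto
  have "\<not> P i" using not_less_Least[of i P] i by (simp add: j_def)
  then have "s \<in> cell t n i" using j(1) i by (auto simp: P_def)
  moreover have "i < Suc n" using j(2) i by simp
  ultimately show ?thesis by blast
qed

lemma sum_cell:
  fixes F :: "nat \<Rightarrow> 'b::real_vector"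
  assumes "0 \<le> t" "i < Suc n" "s \<in> cell t n i"
  shows "(\<Sum>j<Suc n. indicator (cell t n j) s *\<^sub>R F j) = F i"
proof -
  have mono: "mono (grid t n)"
    using grid_mono[OF assms(1)] by (simp add: mono_def)
  have "(\<Sum>j<Suc n. indicator (cell t n j) s *\<^sub>R F j) = (\<Sum>j<Suc n. if j = i then F j else 0)"
  proof (rule sum.cong[OF refl])
    fix j
    have "s \<in> cell t n j \<longleftrightarrow> j = i"
      using mono_Ioc_disjoint[OF mono, of s j i] assms(3) by blast
    then show "indicator (cell t n j) s *\<^sub>R F j = (if j = i then F j else 0)"
      by (simp only: indicator_def) simp
  qed
  then show ?thesis using assms(2) by (simp add: sum.delta')
qed

text \<open>The cells contain \<open>s\<close> and their width \<open>t / real (Suc n)\<close> tends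
  to 0, so both ends are squeezed.\<close>

lemma cell_tendsto:
  assumes "0 \<le> t" "\<And>n. s \<in> cell t n (i n)"
  shows "(\<lambda>n. grid t n (i n)) \<longlonglongrightarrow> s" "(\<lambda>n. grid t n (Suc (i n))) \<longlonglongrightarrow> s"
proof -
  have width: "grid t n (Suc j) = grid t n j + t / real (Suc n)" for n j
    by (simp add: grid_def algebra_simps add_divide_distrib)
  have lim: "(\<lambda>n. t / real (Suc n)) \<longlonglongrightarrow> 0"
    by (rule LIMSEQ_Suc[OF lim_const_over_n])
  have b: "grid t n (i n) < s" "s \<le> grid t n (i n) + t / real (Suc n)" for n
    using assms(2)[of n] by (auto simp: width)
  have "(\<lambda>n. s - t / real (Suc n)) \<longlonglongrightarrow> s" "(\<lambda>n. s + t / real (Suc n)) \<longlonglongrightarrow> s"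
    using tendsto_diff[OF tendsto_const lim, of s] tendsto_add[OF tendsto_const lim, of s] by simp_all
  note l = this
  show "(\<lambda>n. grid t n (i n)) \<longlonglongrightarrow> s"
  proof (rule tendsto_sandwich[OF _ _ l(1) tendsto_const])
    show "\<forall>\<^sub>F n in sequentially. s - t / real (Suc n) \<le> grid t n (i n)"
      by (intro always_eventually allI) (use b(2) in \<open>simp only: diff_le_eq\<close>)
    show "\<forall>\<^sub>F n in sequentially. grid t n (i n) \<le> s"
      by (intro always_eventually allI less_imp_le b(1))
  qed
  then show "(\<lambda>n. grid t n (Suc (i n))) \<longlonglongrightarrow> s"
    unfolding width using tendsto_add[OF _ lim, of _ s] by (simp only: add_0_right)
qed

text \<open>A sum of integrals over cells is one integral of a function glued together from the
  cells, so dominated convergence applies. Convergence is asked for along the cells that contain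
  \<open>s\<close>, which lets \<open>F\<close> sample a path or a coefficient at an end of its
  cell. Both the time integral of \<open>M\<close> and the integral of the rate are handled this
  way.\<close>

lemma grid_sum_integral_tendsto:
  fixes F :: "nat \<Rightarrow> nat \<Rightarrow> real \<Rightarrow> 'b::{banach, second_countable_topology}"
  assumes t: "0 \<le> t"
    and meas [measurable]: "\<And>n i. i < Suc n \<Longrightarrow> set_borel_measurable lborel (cell t n i) (F n i)"
    and lim: "\<And>s i. s \<in> {0<..t} \<Longrightarrow> (\<And>n. i n < Suc n) \<Longrightarrow> (\<And>n. s \<in> cell t n (i n)) \<Longrightarrow>
        (\<lambda>n. F n (i n) s) \<longlonglongrightarrow> G s"
    and bound: "\<And>n i s. i < Suc n \<Longrightarrow> s \<in> cell t n i \<Longrightarrow> norm (F n i s) \<le> w s"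
    and w: "set_integrable lborel {0<..t} w"
  shows "(\<lambda>n. \<Sum>i<Suc n. LINT s:cell t n i|lborel. F n i s) \<longlonglongrightarrow> (LINT s:{0<..t}|lborel. G s)"
proof -
  define S where "S n s = (\<Sum>i<Suc n. indicator (cell t n i) s *\<^sub>R F n i s)" for n s
  have meas_S [measurable]: "S n \<in> borel_measurable lborel" for n
    unfolding S_def using meas unfolding set_borel_measurable_def
    by (intro borel_measurable_sum) auto
  have int_w: "integrable lborel (\<lambda>s. indicator {0<..t} s * w s)"
    using w by (simp add: set_integrable_def)
  have outside: "S n s = 0" if "s \<notin> {0<..t}" for n s
  proof -
    have "s \<notin> cell t n i" if "i < Suc n" for i
      using cell_subset[OF t that] \<open>s \<notin> {0<..t}\<close> by blast
    then show ?thesis unfolding S_def by (intro sum.neutral ballI) (simp only: indicator_simps lessThan_iff scaleR_zero_left not_False_eq_True)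
  qed
  \<comment> \<open>One sequence of cells for all \<open>n\<close> at once, as the limit hypothesis
    speaks about such sequences.\<close>
  have inside: "\<exists>i. (\<forall>n. i n < Suc n \<and> s \<in> cell t n (i n) \<and> S n s = F n (i n) s)"
    if "s \<in> {0<..t}" for s
  proof -
    have "\<forall>n. \<exists>i. i < Suc n \<and> s \<in> cell t n i" using ex_cell[OF that] by blast
    then obtain i where "\<forall>n. i n < Suc n \<and> s \<in> cell t n (i n)" by metis
    moreover from this have "S n s = F n (i n) s" for n
      unfolding S_def by (intro sum_cell[OF t, where F="\<lambda>j. F n j s"]) auto
    ultimately show ?thesis by blast
  qed
  have S_lim: "(\<lambda>n. S n s) \<longlonglongrightarrow> indicator {0<..t} s *\<^sub>R G s" for s
  proof (cases "s \<in> {0<..t}")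
    case True
    from inside[OF this] obtain i
      where "\<forall>n. i n < Suc n \<and> s \<in> cell t n (i n) \<and> S n s = F n (i n) s" by blast
    then show ?thesis using lim[OF True, of i] True by simp
  qed (simp add: outside)
  \<comment> \<open>Measurability of \<open>G\<close> is inherited from the approximations; in the
    application \<open>G\<close> contains a sample path of \<open>M\<close>.\<close>
  have [measurable]: "(\<lambda>s. indicator {0<..t} s *\<^sub>R G s) \<in> borel_measurable lborel"
    by (rule borel_measurable_LIMSEQ_metric[OF meas_S S_lim])
  have S_bound: "norm (S n s) \<le> indicator {0<..t} s * w s" for n s
  proof (cases "s \<in> {0<..t}")
    case True
    with inside[OF True] bound show ?thesis by fastforce
  qed (simp add: outside)
  have int: "integrable lborel (\<lambda>s. indicator (cell t n i) s *\<^sub>R F n i s)" if "i < Suc n" for n i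
  proof (rule Bochner_Integration.integrable_bound[OF int_w])
    show "(\<lambda>s. indicator (cell t n i) s *\<^sub>R F n i s) \<in> borel_measurable lborel"
      using meas[OF that] by (simp add: set_borel_measurable_def)
    show "AE s in lborel. norm (indicator (cell t n i) s *\<^sub>R F n i s) \<le> norm (indicator {0<..t} s * w s)"
    proof (rule AE_I2)
      fix s show "norm (indicator (cell t n i) s *\<^sub>R F n i s) \<le> norm (indicator {0<..t} s * w s)"
      proof (cases "s \<in> cell t n i")
        case True
        then have "s \<in> {0<..t}" using cell_subset[OF t that] by blast
        then show ?thesis using True bound[OF that True] by (simp add: indicator_def)
      qed simp
    qed
  qed
  have "(\<lambda>n. integral\<^sup>L lborel (S n)) \<longlonglongrightarrow> (\<integral>s. indicator {0<..t} s *\<^sub>R G s \<partial>lborel)"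
    by (rule integral_dominated_convergence[OF _ _ int_w]) (auto intro: S_lim S_bound)
  moreover have "integral\<^sup>L lborel (S n) = (\<Sum>i<Suc n. LINT s:cell t n i|lborel. F n i s)" for n
    unfolding S_def set_lebesgue_integral_def by (rule Bochner_Integration.integral_sum) (auto intro: int)
  ultimately show ?thesis by (simp add: set_lebesgue_integral_def)
qed

section \<open>Interval integrals of the power weight\<close>

lemma set_integral_Icc_Ioc:
  fixes f :: "real \<Rightarrow> 'b::{banach, second_countable_topology}"
  shows "(LINT s:{a..b}|lborel. f s) = (LINT s:{a<..b}|lborel. f s)"
  by (rule set_integral_discrete_difference[where X="{a}"]) auto

lemma powr_set_integrable:
  fixes \<alpha> t :: real
  assumes "0 \<le> \<alpha>" "0 \<le> a" "b \<le> t"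
  shows "set_integrable lborel {a..b} (\<lambda>s. (t - s) powr \<alpha>)"
proof -
  have "set_integrable lborel {a..b} (\<lambda>s. t powr \<alpha>)"
    unfolding set_integrable_def
    by (cases "a \<le> b") (auto intro!: integrable_scaleR_left integrable_real_indicator)
  then show ?thesis
    unfolding set_integrable_def
    by (rule Bochner_Integration.integrable_bound)
       (use assms in \<open>auto intro!: AE_I2 powr_mono2 simp: indicator_def\<close>)
qed

lemma powr_integral:
  fixes \<alpha> t :: real
  assumes "0 \<le> \<alpha>" "0 \<le> a" "a \<le> b" "b \<le> t"
  shows "(LINT s:{a<..b}|lborel. (t - s) powr \<alpha>)
    = (t - a) powr (\<alpha> + 1) / (\<alpha> + 1) - (t - b) powr (\<alpha> + 1) / (\<alpha> + 1)"
proof -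
  have "((\<lambda>s. (t - s) powr \<alpha>) has_integral
      - ((t - b) powr (\<alpha> + 1) / (\<alpha> + 1)) - - ((t - a) powr (\<alpha> + 1) / (\<alpha> + 1))) {a..b}"
  \<comment> \<open>The power rule needs a positive base, which is lost at the right end when
    \<open>b = t\<close>; there only continuity is used.\<close>
  proof (rule fundamental_theorem_of_calculus_interior[OF \<open>a \<le> b\<close>])
    show "continuous_on {a..b} (\<lambda>s. - ((t - s) powr (\<alpha> + 1) / (\<alpha> + 1)))"
      using assms by (intro continuous_intros continuous_on_powr') auto
    fix s assume "s \<in> {a<..<b}"
    then have "s < t" using assms by auto
    have "((\<lambda>s. t - s) has_real_derivative - 1) (at s)"
      by (auto intro!: derivative_eq_intros)
    from DERIV_fun_powr[OF this, of "\<alpha> + 1"] \<open>s < t\<close>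
    have "((\<lambda>s. (t - s) powr (\<alpha> + 1)) has_real_derivative - ((\<alpha> + 1) * (t - s) powr \<alpha>)) (at s)"
      by simp
    from DERIV_cdivide[OF DERIV_minus[OF this], of "\<alpha> + 1"]
    show "((\<lambda>s. - ((t - s) powr (\<alpha> + 1) / (\<alpha> + 1))) has_vector_derivative (t - s) powr \<alpha>) (at s)"
      unfolding has_real_derivative_iff_has_vector_derivative[symmetric]
      using assms by simp
  qed
  then have "(LINT s:{a..b}|lborel. (t - s) powr \<alpha>)
    = (t - a) powr (\<alpha> + 1) / (\<alpha> + 1) - (t - b) powr (\<alpha> + 1) / (\<alpha> + 1)"
    using set_borel_integral_eq_integral(2)[OF powr_set_integrable[OF assms(1,2,4)]]
    by (simp add: integral_unique)
  then show ?thesis by (simp add: set_integral_Icc_Ioc)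
qed

subsection \<open>Characteristic functions\<close>

lemma iexp_sum: "finite A \<Longrightarrow> iexp (\<Sum>k\<in>A. f k) = (\<Prod>k\<in>A. iexp (f k))"
  by (simp add: sum_distrib_left exp_sum)

text \<open>Here \<open>n\<close> stands for the values of \<open>N\<close> along a grid once the
  path is frozen. Each jump of block \<open>i\<close> contributes the same factor, and the block has
  \<open>n (Suc i) - n i\<close> members.\<close>

lemma iid_copies_char_blocks:
  assumes "prob_space P" "iid_copies P X Q X0" and [measurable]: "X0 \<in> borel_measurable Q"
    and Q: "prob_space Q" and n: "mono n"
  shows "(CLINT \<omega>|P. iexp (u * (\<Sum>i<m. c i * (\<Sum>k\<in>{n i<..n (Suc i)}. X k \<omega>))))
    = (\<Prod>i<m. char (distr Q borel X0) (u * c i) ^ (n (Suc i) - n i))"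
proof -
  interpret Q: prob_space Q by fact
  let ?\<phi> = "char (distr Q borel X0)"
  define J where "J i = {n i<..n (Suc i)}" for i
  have J: "J i \<subseteq> {1..n m}" if "i < m" for i
    using monoD[OF n, of "Suc i" m] that by (auto simp: J_def)
  have fin: "finite (J i)" for i by (simp add: J_def)
  \<comment> \<open>All factors involving \<open>X k\<close>, gathered into one function of
    \<open>X k\<close>. As the blocks are disjoint, at most one block contributes a factor that is
    not trivially 1.\<close>
  define f where "f k x = (\<Prod>i<m. if k \<in> J i then iexp (u * c i * x) else 1)" for k x
  have [measurable]: "f k \<in> borel_measurable borel" for k
    unfolding f_def by measurable
  have bound: "norm (f k x) \<le> 1" for k x
    unfolding f_def prod_norm[symmetric] by (intro prod_le_1) (auto simp del: of_real_mult)
  \<comment> \<open>Padding with 1 gives every block the same index range, so that the products over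
    \<open>i\<close> and \<open>k\<close> can be exchanged.\<close>
  have block: "(\<Prod>k\<in>J i. y k) = (\<Prod>k=1..n m. if k \<in> J i then y k else 1)"
    if "i < m" for i and y :: "nat \<Rightarrow> complex"
    using J[OF that] by (simp add: prod.If_cases Int_absorb1)
  have "iexp (u * (\<Sum>i<m. c i * (\<Sum>k\<in>{n i<..n (Suc i)}. X k \<omega>)))
      = (\<Prod>k=1..n m. f k (X k \<omega>))" for \<omega>
  proof -
    have "iexp (u * (\<Sum>i<m. c i * (\<Sum>k\<in>{n i<..n (Suc i)}. X k \<omega>)))
        = (\<Prod>i<m. \<Prod>k\<in>J i. iexp (u * c i * X k \<omega>))"
      unfolding J_def sum_distrib_left by (simp only: iexp_sum finite_lessThan finite_greaterThanAtMost mult.assoc)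
    also have "\<dots> = (\<Prod>i<m. \<Prod>k=1..n m. if k \<in> J i then iexp (u * c i * X k \<omega>) else 1)"
      by (intro prod.cong refl block) auto
    also have "\<dots> = (\<Prod>k=1..n m. f k (X k \<omega>))"
      unfolding f_def by (rule prod.swap)
    finally show ?thesis .
  qed
  then have "(CLINT \<omega>|P. iexp (u * (\<Sum>i<m. c i * (\<Sum>k\<in>{n i<..n (Suc i)}. X k \<omega>))))
      = (CLINT \<omega>|P. \<Prod>k=1..n m. f k (X k \<omega>))"
    by simp
  also have "\<dots> = (\<Prod>k=1..n m. \<integral>\<omega>. f k (X0 \<omega>) \<partial>Q)"
    by (rule iid_copies_integral_prod[OF assms(1,2) _ bound]) simp
  also have "\<dots> = (\<Prod>k=1..n m. \<Prod>i<m. if k \<in> J i then ?\<phi> (u * c i) else 1)"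
  proof (rule prod.cong[OF refl])
    fix k
    show "(\<integral>\<omega>. f k (X0 \<omega>) \<partial>Q) = (\<Prod>i<m. if k \<in> J i then ?\<phi> (u * c i) else 1)"
    \<comment> \<open>Either exactly one block contains \<open>k\<close> and one characteristic
      function survives, or the integrand is 1 and the integral is the total mass of
      \<open>Q\<close>.\<close>
    proof (cases "\<exists>i<m. k \<in> J i")
      case True
      then obtain j where j: "j < m" "k \<in> J j" by blast
      have only: "k \<in> J i \<longleftrightarrow> i = j" for i
        using mono_Ioc_disjoint[OF n, of k i j] j(2) by (auto simp: J_def)
      show ?thesis
        using j(1) by (simp add: f_def only prod.delta char_def integral_distr mult.assoc)
    next
      case False
      then show ?thesis by (simp add: f_def Q.prob_space)
    qed
  qed
  also have "\<dots> = (\<Prod>i<m. \<Prod>k=1..n m. if k \<in> J i then ?\<phi> (u * c i) else 1)"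
    by (rule prod.swap)
  also have "\<dots> = (\<Prod>i<m. \<Prod>k\<in>J i. ?\<phi> (u * c i))"
    by (intro prod.cong refl block[symmetric]) auto
  also have "\<dots> = (\<Prod>i<m. ?\<phi> (u * c i) ^ (n (Suc i) - n i))"
    by (simp add: J_def)
  finally show ?thesis .
qed

text \<open>The random limits of summation take countably many values. For fixed limits the sum is
  finite and its indices exceed a natural number, hence are at least 1.\<close>

lemma measurable_sum_seq:
  fixes p q :: "'a \<Rightarrow> nat"
  assumes "\<And>k. k \<ge> 1 \<Longrightarrow> Y k \<in> borel_measurable L"
    and [measurable]: "p \<in> measurable L (count_space UNIV)" "q \<in> measurable L (count_space UNIV)"
  shows "(\<lambda>x. \<Sum>k\<in>{p x<..q x}. Y k x :: real) \<in> borel_measurable L"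
proof (rule measurable_compose_countable[where g=q])
  fix j
  show "(\<lambda>x. \<Sum>k\<in>{p x<..j}. Y k x) \<in> borel_measurable L"
  proof (rule measurable_compose_countable[where g=p])
    show "(\<lambda>x. \<Sum>k\<in>{i<..j}. Y k x) \<in> borel_measurable L" for i
      by (intro borel_measurable_sum assms(1)) auto
  qed simp
qed simp

lemma poisson_process_pmf:
  assumes "poisson_process P rate N" "0 \<le> s" "s \<le> t"
  shows "measure P {\<omega> \<in> space P. N t \<omega> - N s \<omega> = k} =
    (LINT u:{s..t}|lborel. rate u) ^ k / fact k * exp (- (LINT u:{s..t}|lborel. rate u))"
  using assms unfolding poisson_process_def by blast

text \<open>Freezing the path of \<open>N\<close> turns the jumps into deterministic blocks and
  leaves a product of powers. Independent increments split its expectation, and the Poisson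
  generating function evaluates each factor.\<close>

lemma poisson_process_increment_char:
  assumes "prob_space P" "prob_space Q" and [measurable]: "X0 \<in> borel_measurable Q"
    and pp: "poisson_process P rate N" and iid: "iid_copies P X Q X0"
    and indep: "indep_elements P process_space (process_path N) seq_space (seq_path X)"
    and \<tau>: "mono \<tau>" "0 \<le> \<tau> 0"
  shows "(CLINT \<omega>|P. iexp (u * (\<Sum>i<m. c i * (\<Sum>k\<in>{N (\<tau> i) \<omega><..N (\<tau> (Suc i)) \<omega>}. X k \<omega>))))
    = exp (\<Sum>i<m. of_real (LINT s:{\<tau> i..\<tau> (Suc i)}|lborel. rate s)
        * (char (distr Q borel X0) (u * c i) - 1))"
proof -
  interpret prob_space P by fact
  interpret Q: prob_space Q by fact
  interpret D: real_distribution "distr Q borel X0" by simp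
  let ?\<phi> = "char (distr Q borel X0)"
  have \<tau>0: "0 \<le> \<tau> i" for i using \<tau> monoD[OF \<tau>(1), of 0 i] by simp
  have [measurable]: "N (\<tau> i) \<in> measurable P (count_space UNIV)" for i
    using pp \<tau>0 by (simp add: poisson_process_def)
  \<comment> \<open>The random quantity as a function on the product spaces. The restrictions in
    \<open>process_path\<close> and \<open>seq_path\<close> do no harm, as only times
    \<open>\<tau> i \<ge> 0\<close> and indices \<open>k \<ge> 1\<close> are read.\<close>
  let ?h = "\<lambda>(p, x). iexp (u * (\<Sum>i<m. c i * (\<Sum>k\<in>{p (\<tau> i)<..p (\<tau> (Suc i))}. x k)))"
  have p_meas: "(\<lambda>z. fst z (\<tau> i)) \<in> measurable (process_space \<Otimes>\<^sub>M seq_space) (count_space UNIV)" for i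
    using \<tau>0 by (intro measurable_compose[OF measurable_fst] measurable_component_singleton) auto
  have [measurable]: "(\<lambda>z. \<Sum>k\<in>{fst z (\<tau> i)<..fst z (\<tau> (Suc i))}. snd z k :: real)
      \<in> borel_measurable (process_space \<Otimes>\<^sub>M seq_space)" for i
    by (rule measurable_sum_seq[OF _ p_meas p_meas])
       (auto intro!: measurable_compose[OF measurable_snd] measurable_component_singleton)
  have h: "?h \<in> borel_measurable (process_space \<Otimes>\<^sub>M seq_space)"
    unfolding case_prod_beta by measurable
  have "(CLINT \<omega>|P. iexp (u * (\<Sum>i<m. c i * (\<Sum>k\<in>{N (\<tau> i) \<omega><..N (\<tau> (Suc i)) \<omega>}. X k \<omega>))))
      = (CLINT \<omega>|P. ?h (process_path N \<omega>, seq_path X \<omega>))"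
    using \<tau>0 by simp
  also have "\<dots> = (CLINT \<omega>|P. CLINT \<omega>'|P. ?h (process_path N \<omega>, seq_path X \<omega>'))"
    by (rule indep_elements_integral[OF assms(1) indep h, of 1])
       (auto simp: case_prod_beta simp del: of_real_mult of_real_sum)
  also have "\<dots> = (CLINT \<omega>|P. \<Prod>i<m. ?\<phi> (u * c i) ^ (N (\<tau> (Suc i)) \<omega> - N (\<tau> i) \<omega>))"
  proof (rule Bochner_Integration.integral_cong[OF refl])
    fix \<omega> assume "\<omega> \<in> space P"
    then have "mono_on {0..} (\<lambda>s. N s \<omega>)" using pp by (auto simp: poisson_process_def)
    then have "mono (\<lambda>i. N (\<tau> i) \<omega>)"
      using \<tau>0 \<tau>(1) by (auto simp: mono_on_def mono_def)
    from iid_copies_char_blocks[OF assms(1) iid assms(3,2) this]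
    show "(CLINT \<omega>'|P. ?h (process_path N \<omega>, seq_path X \<omega>'))
        = (\<Prod>i<m. ?\<phi> (u * c i) ^ (N (\<tau> (Suc i)) \<omega> - N (\<tau> i) \<omega>))"
      using \<tau>0 by simp
  qed
  also have "\<dots> = (\<Prod>i<m. CLINT \<omega>|P. ?\<phi> (u * c i) ^ (N (\<tau> (Suc i)) \<omega> - N (\<tau> i) \<omega>))"
  proof (rule indep_vars_lebesgue_integral)
    have "indep_vars (\<lambda>_. count_space UNIV) (\<lambda>i \<omega>. N (\<tau> (Suc i)) \<omega> - N (\<tau> i) \<omega>) {..<m}"
      using pp \<tau> by (auto simp: poisson_process_def mono_imp_mono_on)
    from indep_vars_compose2[OF this, of "\<lambda>i j. ?\<phi> (u * c i) ^ j" "\<lambda>_. borel"]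
    show "indep_vars (\<lambda>_. borel) (\<lambda>i \<omega>. ?\<phi> (u * c i) ^ (N (\<tau> (Suc i)) \<omega> - N (\<tau> i) \<omega>)) {..<m}"
      by simp
    show "complex_integrable P (\<lambda>\<omega>. ?\<phi> (u * c i) ^ (N (\<tau> (Suc i)) \<omega> - N (\<tau> i) \<omega>))" for i
      by (intro integrable_const_bound[where B=1])
         (auto simp: norm_power D.cmod_char_le_1 power_le_one)
  qed simp
  also have "\<dots> = (\<Prod>i<m. exp (of_real (LINT s:{\<tau> i..\<tau> (Suc i)}|lborel. rate s) * (?\<phi> (u * c i) - 1)))"
  proof (intro prod.cong refl poisson_integral_power[OF assms(1)])
    fix i k
    show "measure P {\<omega> \<in> space P. N (\<tau> (Suc i)) \<omega> - N (\<tau> i) \<omega> = k} =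
        (LINT s:{\<tau> i..\<tau> (Suc i)}|lborel. rate s) ^ k / fact k * exp (- (LINT s:{\<tau> i..\<tau> (Suc i)}|lborel. rate s))"
      by (rule poisson_process_pmf[OF pp \<tau>0 monoD[OF \<tau>(1)]]) simp
  qed (simp_all add: D.cmod_char_le_1)
  also have "\<dots> = exp (\<Sum>i<m. of_real (LINT s:{\<tau> i..\<tau> (Suc i)}|lborel. rate s) * (?\<phi> (u * c i) - 1))"
    by (simp add: exp_sum)
  finally show ?thesis .
qed

text \<open>Two conditionings in succession: with \<open>N\<close> and \<open>X\<close> frozen,
  \<open>Lam\<close> is averaged out; with \<open>N\<close> frozen, \<open>X\<close> is averaged
  out. What remains is the expectation of a power with exponent \<open>N t\<close>.\<close>

lemma marked_poisson_char:
  assumes "prob_space P" "prob_space Q" "prob_space R"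
    and [measurable]: "X0 \<in> borel_measurable Q" "Lam0 \<in> borel_measurable R" "g \<in> borel_measurable borel"
    and pp: "poisson_process P rate N" and X: "iid_copies P X Q X0" and L: "iid_copies P Lam R Lam0"
    and indep: "indep_elements P process_space (process_path N) seq_space (seq_path X)"
    and indep2: "indep_elements P
           (process_space \<Otimes>\<^sub>M seq_space) (\<lambda>\<omega>. (process_path N \<omega>, seq_path X \<omega>))
           seq_space (seq_path Lam)"
    and t: "0 \<le> t"
  shows "(CLINT \<omega>|P. iexp (u * (\<Sum>k=1..N t \<omega>. X k \<omega> * g (Lam k \<omega>))))
    = exp (of_real (LINT s:{0..t}|lborel. rate s)
        * ((CLINT \<omega>|R. char (distr Q borel X0) (u * g (Lam0 \<omega>))) - 1))"
proof -
  interpret prob_space P by fact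
  interpret Q: prob_space Q by fact
  interpret R: prob_space R by fact
  interpret D: real_distribution "distr Q borel X0" by simp
  interpret E: real_distribution "distr R borel (\<lambda>\<omega>. g (Lam0 \<omega>))" by simp
  interpret QR: pair_prob_space Q R ..
  let ?\<phi> = "char (distr Q borel X0)"
  let ?\<chi> = "char (distr R borel (\<lambda>\<omega>. g (Lam0 \<omega>)))"
  define \<psi> where "\<psi> = (CLINT \<omega>|Q. ?\<chi> (u * X0 \<omega>))"
  \<comment> \<open>The order of conditioning produces a mean over the jump of the characteristic
    function of the mark. Fubini turns it into a mean over the mark of the characteristic function
    of the jump, the form that can be compared with a rate integral.\<close>
  have "\<psi> = (CLINT x|Q. CLINT y|R. iexp (u * (X0 x * g (Lam0 y))))"
    unfolding \<psi>_def char_def by (simp add: integral_distr mult.assoc)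
  also have "\<dots> = (CLINT y|R. CLINT x|Q. iexp (u * (X0 x * g (Lam0 y))))"
    by (rule QR.Fubini_integral[symmetric])
       (auto intro!: QR.integrable_const_bound[where B=1] simp: case_prod_beta simp del: of_real_mult)
  also have "\<dots> = (CLINT \<omega>|R. ?\<phi> (u * g (Lam0 \<omega>)))"
    unfolding char_def by (simp add: integral_distr mult_ac)
  finally have \<psi>: "\<psi> = (CLINT \<omega>|R. ?\<phi> (u * g (Lam0 \<omega>)))" .
  \<comment> \<open>The Poisson generating function is evaluated at \<psi>, so \<psi> has to lie in
    the closed unit disc.\<close>
  have \<psi>_le: "norm \<psi> \<le> 1"
  proof -
    have "norm \<psi> \<le> (\<integral>\<omega>. norm (?\<chi> (u * X0 \<omega>)) \<partial>Q)"
      unfolding \<psi>_def by (rule integral_norm_bound)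
    also have "\<dots> \<le> (\<integral>\<omega>. 1 \<partial>Q)"
      by (intro integral_mono Q.integrable_const_bound[where B=1]) (auto simp: E.cmod_char_le_1)
    finally show ?thesis by (simp add: Q.prob_space)
  qed
  have N_meas: "N t \<in> measurable P (count_space UNIV)"
    using pp t by (simp add: poisson_process_def)

  let ?h = "\<lambda>((p, x), l). iexp (u * (\<Sum>k\<in>{0<..p t}. x k * g (l k)))"
  have [measurable]: "(\<lambda>z. fst (fst z) t) \<in> measurable ((process_space \<Otimes>\<^sub>M seq_space) \<Otimes>\<^sub>M seq_space) (count_space UNIV)"
    using t by (intro measurable_compose[OF measurable_fst] measurable_component_singleton) auto
  have [measurable]: "(\<lambda>z. snd (fst z) k) \<in> measurable ((process_space \<Otimes>\<^sub>M seq_space) \<Otimes>\<^sub>M seq_space) borel"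
    "(\<lambda>z. snd z k) \<in> measurable ((process_space \<Otimes>\<^sub>M seq_space) \<Otimes>\<^sub>M seq_space) borel" if "k \<ge> 1" for k :: nat
    using that
    by (auto intro!: measurable_compose[OF measurable_fst] measurable_compose[OF measurable_snd] measurable_component_singleton)
  have [measurable]: "(\<lambda>z. \<Sum>k\<in>{0<..fst (fst z) t}. snd (fst z) k * g (snd z k))
      \<in> borel_measurable ((process_space \<Otimes>\<^sub>M seq_space) \<Otimes>\<^sub>M seq_space)"
    by (rule measurable_sum_seq) measurable
  have h: "?h \<in> borel_measurable ((process_space \<Otimes>\<^sub>M seq_space) \<Otimes>\<^sub>M seq_space)"
    unfolding case_prod_beta by measurable

  \<comment> \<open>What is left after averaging out \<open>Lam\<close>, again as a function on a
    product space so that the second conditioning applies.\<close>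
  let ?h' = "\<lambda>(p, x). \<Prod>k\<in>{0<..p t}. ?\<chi> (u * x k)"
  have p_meas: "(\<lambda>z. fst z t) \<in> measurable (process_space \<Otimes>\<^sub>M seq_space) (count_space UNIV)"
    using t by (intro measurable_compose[OF measurable_fst] measurable_component_singleton) auto
  have x_meas: "(\<lambda>z. snd z k) \<in> measurable (process_space \<Otimes>\<^sub>M seq_space) borel" if "k \<ge> 1" for k :: nat
    using that by (auto intro!: measurable_compose[OF measurable_snd] measurable_component_singleton)
  have h': "?h' \<in> borel_measurable (process_space \<Otimes>\<^sub>M seq_space)"
    unfolding case_prod_beta
  proof (rule measurable_compose_countable[OF _ p_meas])
    show "(\<lambda>z. \<Prod>k\<in>{0<..i}. ?\<chi> (u * snd z k)) \<in> borel_measurable (process_space \<Otimes>\<^sub>M seq_space)" for i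
      by (intro borel_measurable_prod measurable_compose[OF _ E.char_measurable]
          borel_measurable_times borel_measurable_const x_meas) auto
  qed

  have Ioc: "{0<..n} = {1..n}" for n :: nat by auto
  have "(CLINT \<omega>|P. iexp (u * (\<Sum>k=1..N t \<omega>. X k \<omega> * g (Lam k \<omega>))))
      = (CLINT \<omega>|P. ?h ((process_path N \<omega>, seq_path X \<omega>), seq_path Lam \<omega>))"
    using t by (simp add: Ioc)
  also have "\<dots> = (CLINT \<omega>|P. CLINT \<omega>'|P. ?h ((process_path N \<omega>, seq_path X \<omega>), seq_path Lam \<omega>'))"
    by (rule indep_elements_integral[OF assms(1) indep2 h, of 1])
       (auto simp: case_prod_beta simp del: of_real_mult of_real_sum)
  also have "\<dots> = (CLINT \<omega>|P. ?h' (process_path N \<omega>, seq_path X \<omega>))"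
  proof (rule Bochner_Integration.integral_cong[OF refl])
    fix \<omega>
    have "(CLINT \<omega>'|P. ?h ((process_path N \<omega>, seq_path X \<omega>), seq_path Lam \<omega>'))
        = (CLINT \<omega>'|P. \<Prod>k=1..N t \<omega>. iexp (u * (X k \<omega> * g (Lam k \<omega>'))))"
      using t by (simp add: Ioc sum_distrib_left exp_sum)
    also have "\<dots> = (\<Prod>k=1..N t \<omega>. CLINT \<omega>'|R. iexp (u * (X k \<omega> * g (Lam0 \<omega>'))))"
      by (rule iid_copies_integral_prod[OF assms(1) L, where B=1]) (simp_all del: of_real_mult)
    also have "\<dots> = ?h' (process_path N \<omega>, seq_path X \<omega>)"
      using t by (simp add: Ioc char_def integral_distr mult.assoc)
    finally show "(CLINT \<omega>'|P. ?h ((process_path N \<omega>, seq_path X \<omega>), seq_path Lam \<omega>'))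
        = ?h' (process_path N \<omega>, seq_path X \<omega>)" .
  qed
  also have "\<dots> = (CLINT \<omega>|P. CLINT \<omega>'|P. ?h' (process_path N \<omega>, seq_path X \<omega>'))"
    by (rule indep_elements_integral[OF assms(1) indep h', of 1])
       (auto simp: case_prod_beta prod_norm[symmetric] intro!: prod_le_1 E.cmod_char_le_1)
  also have "\<dots> = (CLINT \<omega>|P. \<psi> ^ N t \<omega>)"
  proof (rule Bochner_Integration.integral_cong[OF refl])
    fix \<omega>
    have "(CLINT \<omega>'|P. ?h' (process_path N \<omega>, seq_path X \<omega>')) = (CLINT \<omega>'|P. \<Prod>k=1..N t \<omega>. ?\<chi> (u * X k \<omega>'))"
      using t by (simp add: Ioc)
    also have "\<dots> = (\<Prod>k=1..N t \<omega>. \<psi>)"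
      unfolding \<psi>_def
      by (rule iid_copies_integral_prod[OF assms(1) X, where B=1]) (simp_all add: E.cmod_char_le_1)
    finally show "(CLINT \<omega>'|P. ?h' (process_path N \<omega>, seq_path X \<omega>')) = \<psi> ^ N t \<omega>"
      by simp
  qed
  also have "\<dots> = exp (of_real (LINT s:{0..t}|lborel. rate s) * (\<psi> - 1))"
  proof (rule poisson_integral_power[OF assms(1) N_meas _ \<psi>_le])
    fix k
    \<comment> \<open>Paths start at 0, so \<open>N t\<close> is the increment over
      \<open>{0..t}\<close>.\<close>
    have "{\<omega> \<in> space P. N t \<omega> - N 0 \<omega> = k} = {\<omega> \<in> space P. N t \<omega> = k}"
      using pp by (auto simp: poisson_process_def)
    then show "measure P {\<omega> \<in> space P. N t \<omega> = k} =
        (LINT s:{0..t}|lborel. rate s) ^ k / fact k * exp (- (LINT s:{0..t}|lborel. rate s))"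
      using poisson_process_pmf[OF pp order_refl t, of k] by simp
  qed
  finally show ?thesis unfolding \<psi> .
qed

section \<open>The time integral as a pathwise limit of weighted increments\<close>

text \<open>Abel summation: the differences move from the weights \<open>a\<close> to the path
  values \<open>b\<close>.\<close>

lemma sum_by_parts:
  fixes a b :: "nat \<Rightarrow> real"
  shows "(\<Sum>i<m. (a i - a (Suc i)) * b (Suc i)) = (\<Sum>i<m. a i * (b (Suc i) - b i)) + a 0 * b 0 - a m * b m"
  by (induction m) (simp_all add: algebra_simps)

lemma sum_Ioc_diff:
  fixes x :: "nat \<Rightarrow> real"
  assumes "p \<le> q"
  shows "(\<Sum>k\<in>{p<..q}. x k) = (\<Sum>k=1..q. x k) - (\<Sum>k=1..p. x k)"
proof -
  have "{1..q} = {1..p} \<union> {p<..q}" "{1..p} \<inter> {p<..q} = {}" using assms by auto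
  then show ?thesis by (simp add: sum.union_disjoint)
qed

text \<open>Sampling \<open>M\<close> at the right end of each cell makes right-continuity
  sufficient at every \<open>s\<close>, jump times included. The weight is integrated exactly on
  each cell, so only \<open>M\<close> is discretised.\<close>

lemma compound_poisson_integral_limit:
  fixes \<alpha> t :: real
  assumes cp: "compound_poisson P rate Q X0 N X M" and \<omega>: "\<omega> \<in> space P"
    and \<alpha>: "0 \<le> \<alpha>" and t: "0 \<le> t"
  defines "g \<equiv> \<lambda>s. (t - s) powr (\<alpha> + 1) / (\<alpha> + 1)"
  shows "(\<lambda>n. \<Sum>i<Suc n. g (grid t n i) * (\<Sum>k\<in>{N (grid t n i) \<omega><..N (grid t n (Suc i)) \<omega>}. X k \<omega>))
    \<longlonglongrightarrow> (LINT s:{0..t}|lborel. (t - s) powr \<alpha> * M s \<omega>)"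
proof -
  have pp: "poisson_process P rate N"
    and M: "\<And>s. 0 \<le> s \<Longrightarrow> M s \<omega> = (\<Sum>k=1..N s \<omega>. X k \<omega>)"
    using cp \<omega> by (auto simp: compound_poisson_def)
  have N0: "N 0 \<omega> = 0" and mono: "\<And>r s. 0 \<le> r \<Longrightarrow> r \<le> s \<Longrightarrow> N r \<omega> \<le> N s \<omega>"
    and cont: "\<And>s. 0 \<le> s \<Longrightarrow> continuous (at_right s) (\<lambda>s. N s \<omega>)"
    using pp \<omega> by (auto simp: poisson_process_def mono_on_def)
  \<comment> \<open>A dominating constant: up to time \<open>t\<close> only the first
    \<open>N t \<omega>\<close> jumps contribute, whatever their signs.\<close>
  define B where "B = (\<Sum>k=1..N t \<omega>. \<bar>X k \<omega>\<bar>)"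
  have M_bound: "\<bar>M s \<omega>\<bar> \<le> B" if "0 \<le> s" "s \<le> t" for s
  proof -
    have "\<bar>M s \<omega>\<bar> \<le> (\<Sum>k=1..N s \<omega>. \<bar>X k \<omega>\<bar>)"
      unfolding M[OF that(1)] by (rule sum_abs)
    also have "\<dots> \<le> B"
      unfolding B_def using mono[OF that] by (intro sum_mono2) auto
    finally show ?thesis .
  qed
  have "(\<lambda>n. \<Sum>i<Suc n. LINT s:cell t n i|lborel. (t - s) powr \<alpha> * M (grid t n (Suc i)) \<omega>)
      \<longlonglongrightarrow> (LINT s:{0<..t}|lborel. (t - s) powr \<alpha> * M s \<omega>)"
  proof (rule grid_sum_integral_tendsto[OF t, where w="\<lambda>s. t powr \<alpha> * B"])
    show "set_borel_measurable lborel (cell t n i) (\<lambda>s. (t - s) powr \<alpha> * M (grid t n (Suc i)) \<omega>)" for n i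
      unfolding set_borel_measurable_def by measurable
    show "(\<lambda>n. (t - s) powr \<alpha> * M (grid t n (Suc (i n))) \<omega>) \<longlonglongrightarrow> (t - s) powr \<alpha> * M s \<omega>"
      if s: "s \<in> {0<..t}" and i: "\<And>n. i n < Suc n" "\<And>n. s \<in> cell t n (i n)" for s i
    proof -
      \<comment> \<open>For a path with discrete values, right-continuity means being constant on
        some interval to the right of \<open>s\<close>.\<close>
      have "eventually (\<lambda>r. N r \<omega> = N s \<omega>) (at_right s)"
        using cont[of s] s by (simp add: continuous_within tendsto_discrete)
      then obtain b where b: "s < b" "\<And>r. s < r \<Longrightarrow> r < b \<Longrightarrow> N r \<omega> = N s \<omega>"
        unfolding eventually_at_right_field by blast
      have "eventually (\<lambda>n. grid t n (Suc (i n)) < b) sequentially"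
        using cell_tendsto(2)[OF t i(2)] b(1) by (rule order_tendstoD)
      then have "eventually (\<lambda>n. M (grid t n (Suc (i n))) \<omega> = M s \<omega>) sequentially"
      proof eventually_elim
        case (elim n)
        \<comment> \<open>The right end of the cell is \<open>s\<close> itself or lies strictly
          between \<open>s\<close> and \<open>b\<close>.\<close>
        have "N (grid t n (Suc (i n))) \<omega> = N s \<omega>"
          using i(2)[of n] elim b(2)[of "grid t n (Suc (i n))"]
          by (cases "grid t n (Suc (i n)) = s") auto
        then show ?case using s t by (simp add: M)
      qed
      then show ?thesis
        by (intro tendsto_mult tendsto_const tendsto_eventually)
    qed
    show "norm ((t - s) powr \<alpha> * M (grid t n (Suc i)) \<omega>) \<le> t powr \<alpha> * B"
      if i: "i < Suc n" and s: "s \<in> cell t n i" for n i s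
    proof -
      have "s \<in> {0<..t}" using cell_subset[OF t i] s by blast
      then have "(t - s) powr \<alpha> \<le> t powr \<alpha>" using \<alpha> by (intro powr_mono2) auto
      moreover have "\<bar>M (grid t n (Suc i)) \<omega>\<bar> \<le> B"
        using t i by (intro M_bound grid_nonneg grid_le) auto
      ultimately show ?thesis by (auto simp: abs_mult intro!: mult_mono)
    qed
    show "set_integrable lborel {0<..t} (\<lambda>s. t powr \<alpha> * B)"
      unfolding set_integrable_def
      using t by (intro integrable_scaleR_left integrable_real_indicator) auto
  qed
  moreover have "(\<Sum>i<Suc n. LINT s:cell t n i|lborel. (t - s) powr \<alpha> * M (grid t n (Suc i)) \<omega>)
      = (\<Sum>i<Suc n. g (grid t n i) * (\<Sum>k\<in>{N (grid t n i) \<omega><..N (grid t n (Suc i)) \<omega>}. X k \<omega>))" for n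
  proof -
    have "(\<Sum>i<Suc n. LINT s:cell t n i|lborel. (t - s) powr \<alpha> * M (grid t n (Suc i)) \<omega>)
        = (\<Sum>i<Suc n. (g (grid t n i) - g (grid t n (Suc i))) * M (grid t n (Suc i)) \<omega>)"
    proof (rule sum.cong[OF refl])
      fix i assume "i \<in> {..<Suc n}"
      then show "(LINT s:cell t n i|lborel. (t - s) powr \<alpha> * M (grid t n (Suc i)) \<omega>)
          = (g (grid t n i) - g (grid t n (Suc i))) * M (grid t n (Suc i)) \<omega>"
        unfolding g_def
        using powr_integral[where a="grid t n i" and b="grid t n (Suc i)" and t=t, OF \<alpha>]
          grid_nonneg[OF t, of n i] grid_mono[OF t, of i "Suc i" n] grid_le[OF t, of "Suc i" n]
        by simp
    qed
    \<comment> \<open>Both boundary terms vanish: \<open>M 0 \<omega> = 0\<close> because no jump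
      has occurred, and \<open>g\<close> is 0 at the last grid point \<open>t\<close>.\<close>
    also have "\<dots> = (\<Sum>i<Suc n. g (grid t n i) * (M (grid t n (Suc i)) \<omega> - M (grid t n i) \<omega>))"
      using sum_by_parts[of "\<lambda>i. g (grid t n i)" "\<lambda>i. M (grid t n i) \<omega>" "Suc n"]
      by (simp add: g_def M N0 del: sum.lessThan_Suc)
    also have "\<dots> = (\<Sum>i<Suc n. g (grid t n i) * (\<Sum>k\<in>{N (grid t n i) \<omega><..N (grid t n (Suc i)) \<omega>}. X k \<omega>))"
      using t mono grid_mono[OF t] by (intro sum.cong refl) (simp add: M sum_Ioc_diff)
    finally show ?thesis .
  qed
  ultimately show ?thesis by (simp only: set_integral_Icc_Ioc)
qed

section \<open>The exponent as a limit of grid sums and as a mean over the mark\<close>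

text \<open>These are Stieltjes sums of \<open>z\<close> against the integrated rate. On each cell
  \<open>z\<close> is frozen at the left end, continuity gives the pointwise limit, and
  \<open>rate s * B\<close> dominates.\<close>

lemma rate_integral_limit:
  fixes z :: "real \<Rightarrow> complex"
  assumes rate: "rate_function rate" and t: "0 \<le> t"
    and z: "continuous_on {0..t} z" and bound: "\<And>s. norm (z s) \<le> B"
  shows "(\<lambda>n. \<Sum>i<Suc n. of_real (LINT s:{grid t n i..grid t n (Suc i)}|lborel. rate s) * z (grid t n i))
    \<longlonglongrightarrow> (CLINT s:{0..t}|lborel. rate s *\<^sub>R z s)"
proof -
  have int: "set_integrable lborel {0..t} rate" and nonneg: "\<And>s. 0 \<le> s \<Longrightarrow> 0 \<le> rate s"
    using rate t by (auto simp: rate_function_def)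
  have int_sub: "set_integrable lborel A rate" if "A \<subseteq> {0..t}" "A \<in> sets lborel" for A
    using set_integrable_subset[OF int] that by blast
  have cell_sub: "cell t n i \<subseteq> {0..t}" if "i < Suc n" for n i
    using cell_subset[OF t that] by auto
  have "(\<lambda>n. \<Sum>i<Suc n. CLINT s:cell t n i|lborel. rate s *\<^sub>R z (grid t n i))
      \<longlonglongrightarrow> (CLINT s:{0<..t}|lborel. rate s *\<^sub>R z s)"
  proof (rule grid_sum_integral_tendsto[OF t, where w="\<lambda>s. rate s * B"])
    show "set_borel_measurable lborel (cell t n i) (\<lambda>s. rate s *\<^sub>R z (grid t n i))" if "i < Suc n" for n i
    proof -
      have "(\<lambda>s. indicator (cell t n i) s *\<^sub>R rate s) \<in> borel_measurable lborel"
        using int_sub[OF cell_sub[OF that]] by (auto simp: set_integrable_def)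
      from borel_measurable_scaleR[OF this borel_measurable_const]
      show ?thesis by (simp add: set_borel_measurable_def)
    qed
    show "(\<lambda>n. rate s *\<^sub>R z (grid t n (i n))) \<longlonglongrightarrow> rate s *\<^sub>R z s"
      if s: "s \<in> {0<..t}" and i: "\<And>n. i n < Suc n" "\<And>n. s \<in> cell t n (i n)" for s i
    proof (intro tendsto_intros)
      have "grid t n (i n) \<in> {0..t}" for n
        using t i(1)[of n] by (auto intro!: grid_le)
      then show "(\<lambda>n. z (grid t n (i n))) \<longlonglongrightarrow> z s"
        using s by (intro continuous_on_tendsto_compose[OF z cell_tendsto(1)[OF t i(2)]]) auto
    qed
    show "norm (rate s *\<^sub>R z (grid t n i)) \<le> rate s * B" if "i < Suc n" "s \<in> cell t n i" for n i s
    proof -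
      have "0 \<le> rate s" using cell_sub[OF that(1)] that(2) by (intro nonneg) auto
      then show ?thesis using bound by (simp add: mult_left_mono)
    qed
    show "set_integrable lborel {0<..t} (\<lambda>s. rate s * B)"
      by (intro set_integrable_mult_left int_sub) auto
  qed
  moreover have "(CLINT s:cell t n i|lborel. rate s *\<^sub>R z (grid t n i))
      = of_real (LINT s:{grid t n i..grid t n (Suc i)}|lborel. rate s) * z (grid t n i)"
    if "i < Suc n" for n i
  proof -
    have "(CLINT s:cell t n i|lborel. rate s *\<^sub>R z (grid t n i))
        = (\<integral>s. (indicator (cell t n i) s *\<^sub>R rate s) *\<^sub>R z (grid t n i) \<partial>lborel)"
      by (simp add: set_lebesgue_integral_def)
    also have "\<dots> = (LINT s:cell t n i|lborel. rate s) *\<^sub>R z (grid t n i)"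
      unfolding set_lebesgue_integral_def
      by (rule integral_scaleR_left) (use int_sub[OF cell_sub[OF that]] in \<open>simp add: set_integrable_def\<close>)
    finally show ?thesis by (simp add: set_integral_Icc_Ioc scaleR_conv_of_real)
  qed
  ultimately show ?thesis by (simp add: set_integral_Icc_Ioc del: sum.lessThan_Suc)
qed

text \<open>This links the two exponents: one is an integral against the rate, the other a mean over
  \<open>Lam0\<close>, whose density is the rate divided by its total mass on
  \<open>{0..t}\<close>.\<close>

lemma rate_integral_density:
  fixes z :: "real \<Rightarrow> complex"
  assumes rate: "rate_function rate" and t: "0 \<le> t"
    and dens: "0 < (LINT u:{0..t}|lborel. rate u) \<Longrightarrow>
           distributed R lborel Lam0
             (\<lambda>s. ennreal (indicator {0..t} s * rate s / (LINT u:{0..t}|lborel. rate u)))"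
    and [measurable]: "Lam0 \<in> borel_measurable R" "z \<in> borel_measurable borel"
    and bound: "\<And>s. norm (z s) \<le> B"
  shows "(CLINT s:{0..t}|lborel. rate s *\<^sub>R z s)
    = of_real (LINT s:{0..t}|lborel. rate s) * (CLINT \<omega>|R. z (Lam0 \<omega>))"
proof -
  define \<mu> where "\<mu> = (LINT u:{0..t}|lborel. rate u)"
  have int: "set_integrable lborel {0..t} rate" and nonneg: "\<And>s. 0 \<le> s \<Longrightarrow> 0 \<le> rate s"
    using rate t by (auto simp: rate_function_def)
  have [measurable]: "(\<lambda>s. indicator {0..t} s * rate s) \<in> borel_measurable lborel"
    using int by (auto simp: set_integrable_def)
  have nonneg': "0 \<le> indicator {0..t} s * rate s" for s
    using nonneg by (simp add: indicator_def)
  have "0 \<le> \<mu>"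
    unfolding \<mu>_def set_lebesgue_integral_def using nonneg' by (intro integral_nonneg_AE) simp
  then consider "\<mu> = 0" | "0 < \<mu>" by linarith
  then show ?thesis
  proof cases
    \<comment> \<open>No law is prescribed for \<open>Lam0\<close> here, but the rate vanishes
      almost everywhere on \<open>{0..t}\<close>, so both sides are 0.\<close>
    case 1
    then have "AE s in lborel. indicator {0..t} s * rate s = 0"
      using integral_nonneg_eq_0_iff_AE[of lborel "\<lambda>s. indicator {0..t} s * rate s"] int nonneg'
      by (simp add: \<mu>_def set_lebesgue_integral_def set_integrable_def)
    then have "AE s in lborel. indicator {0..t} s *\<^sub>R rate s *\<^sub>R z s = 0"
      by eventually_elim auto
    then have "(CLINT s:{0..t}|lborel. rate s *\<^sub>R z s) = 0"
      unfolding set_lebesgue_integral_def by (rule integral_eq_zero_AE)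
    then show ?thesis using 1 by (simp add: \<mu>_def)
  next
    case 2
    have "(CLINT \<omega>|R. z (Lam0 \<omega>)) = integral\<^sup>L (distr R lborel Lam0) z"
      by (simp add: integral_distr)
    also have "distr R lborel Lam0 = density lborel (\<lambda>s. ennreal (indicator {0..t} s * rate s / \<mu>))"
      using dens 2 unfolding \<mu>_def by (intro distributed_distr_eq_density) auto
    also have "integral\<^sup>L \<dots> z = (\<integral>s. (indicator {0..t} s * rate s / \<mu>) *\<^sub>R z s \<partial>lborel)"
      using nonneg' 2 by (intro integral_density) auto
    also have "\<dots> = (\<integral>s. (1 / \<mu>) *\<^sub>R (indicator {0..t} s *\<^sub>R rate s *\<^sub>R z s) \<partial>lborel)"
      by (intro Bochner_Integration.integral_cong refl) simp
    also have "\<dots> = (1 / \<mu>) *\<^sub>R (CLINT s:{0..t}|lborel. rate s *\<^sub>R z s)"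
      unfolding set_lebesgue_integral_def by (rule integral_scaleR_right)
    finally show ?thesis using 2 by (simp add: \<mu>_def[symmetric] scaleR_conv_of_real)
  qed
qed

section \<open>Comparison of the two characteristic functions\<close>

theorem theorem4p3:
  fixes P :: "'a measure" and Q :: "'b measure" and R :: "'c measure"
    and rate :: "real \<Rightarrow> real" and \<alpha> t :: real
    and X0 :: "'b \<Rightarrow> real" and Lam0 :: "'c \<Rightarrow> real"
    and N :: "real \<Rightarrow> 'a \<Rightarrow> nat" and M :: "real \<Rightarrow> 'a \<Rightarrow> real"
    and X Lam :: "nat \<Rightarrow> 'a \<Rightarrow> real"
  assumes "prob_space P" and "prob_space Q" and "prob_space R"
    and "rate_function rate"
    and "X0 \<in> borel_measurable Q"
    and "compound_poisson P rate Q X0 N X M"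
    and "0 \<le> \<alpha>" and "0 \<le> t"
    and "0 < (LINT u:{0..t}|lborel. rate u) \<Longrightarrow>
           distributed R lborel Lam0
             (\<lambda>s. ennreal (indicator {0..t} s * rate s / (LINT u:{0..t}|lborel. rate u)))"
    and "iid_copies P Lam R Lam0"
    and "indep_elements P
           (process_space \<Otimes>\<^sub>M seq_space) (\<lambda>\<omega>. (process_path N \<omega>, seq_path X \<omega>))
           seq_space (seq_path Lam)"
  shows "eq_in_distr
           P (\<lambda>\<omega>. LINT s:{0..t}|lborel. (t - s) powr \<alpha> * M s \<omega>)
           P (\<lambda>\<omega>. \<Sum>k=1..N t \<omega>. X k \<omega> * ((t - Lam k \<omega>) powr (\<alpha> + 1) / (\<alpha> + 1)))
         \<and> (t = 0 \<longrightarrow> (\<forall>\<omega>\<in>space P.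
              (LINT s:{0..t}|lborel. (t - s) powr \<alpha> * M s \<omega>) = 0 \<and>
              (\<Sum>k=1..N t \<omega>. X k \<omega> * ((t - Lam k \<omega>) powr (\<alpha> + 1) / (\<alpha> + 1))) = 0))"
proof -
  interpret prob_space P by fact
  interpret Q: prob_space Q by fact
  interpret R: prob_space R by fact
  note [measurable] = assms(5)
  interpret D: real_distribution "distr Q borel X0" by simp
  let ?\<phi> = "char (distr Q borel X0)"
  define g where "g s = (t - s) powr (\<alpha> + 1) / (\<alpha> + 1)" for s
  define S where "S n \<omega> = (\<Sum>i<Suc n. g (grid t n i) *
      (\<Sum>k\<in>{N (grid t n i) \<omega><..N (grid t n (Suc i)) \<omega>}. X k \<omega>))" for n \<omega>
  define L where "L \<omega> = (LINT s:{0..t}|lborel. (t - s) powr \<alpha> * M s \<omega>)" for \<omega>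
  define J where "J \<omega> = (\<Sum>k=1..N t \<omega>. X k \<omega> * g (Lam k \<omega>))" for \<omega>
  note t = \<open>0 \<le> t\<close>
  have pp: "poisson_process P rate N" and iid: "iid_copies P X Q X0"
    and indep: "indep_elements P process_space (process_path N) seq_space (seq_path X)"
    using assms(6) by (auto simp: compound_poisson_def)
  have N_meas [measurable]: "N s \<in> measurable P (count_space UNIV)" if "0 \<le> s" for s
    using pp that by (simp add: poisson_process_def)
  have X_meas [measurable]: "X k \<in> borel_measurable P" if "k \<ge> 1" for k
    using iid that by (simp add: iid_copies_def eq_in_distr_def)
  have Lam_meas [measurable]: "Lam k \<in> borel_measurable P" if "k \<ge> 1" for k
    using assms(10) that by (simp add: iid_copies_def eq_in_distr_def)
  have Lam0_meas [measurable]: "Lam0 \<in> borel_measurable R"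
    using assms(10) by (auto simp: iid_copies_def eq_in_distr_def)
  have g_meas [measurable]: "g \<in> borel_measurable borel"
    unfolding g_def by measurable
  have g_cont: "continuous_on {0..t} g"
    unfolding g_def using \<open>0 \<le> \<alpha>\<close> by (intro continuous_intros continuous_on_powr') auto
  have S_meas [measurable]: "S n \<in> borel_measurable P" for n
    unfolding S_def using t
    by (intro borel_measurable_sum borel_measurable_times borel_measurable_const measurable_sum_seq N_meas X_meas) auto
  have S_lim: "(\<lambda>n. S n \<omega>) \<longlonglongrightarrow> L \<omega>" if "\<omega> \<in> space P" for \<omega>
    unfolding S_def L_def g_def
    by (rule compound_poisson_integral_limit[OF assms(6) that assms(7,8)])
  \<comment> \<open>Measurability in \<omega> of the time integral comes from its approximations
    \<open>S n\<close>, which are finite sums of random variables.\<close>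
  have L_meas [measurable]: "L \<in> borel_measurable P"
    by (rule borel_measurable_LIMSEQ_real[OF S_lim S_meas])
  have J_meas [measurable]: "J \<in> borel_measurable P"
  proof -
    have "J = (\<lambda>\<omega>. \<Sum>k\<in>{0<..N t \<omega>}. X k \<omega> * g (Lam k \<omega>))"
      unfolding J_def by (intro ext sum.cong) auto
    also have "\<dots> \<in> borel_measurable P"
      using t by (intro measurable_sum_seq N_meas) auto
    finally show ?thesis .
  qed
  have "char (distr P borel L) u = char (distr P borel J) u" for u
  proof -
    \<comment> \<open>The characteristic function at \<open>u\<close> of \<open>g s * X0\<close>,
      the contribution of a jump at time \<open>s\<close>.\<close>
    define z where "z s = ?\<phi> (u * g s)" for s
    have z_meas: "z \<in> borel_measurable borel"
      unfolding z_def by measurable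
    have z_bound: "norm (z s) \<le> 1" for s
      unfolding z_def by (rule D.cmod_char_le_1)
    have z_cont: "continuous_on {0..t} z"
      unfolding z_def
      by (rule continuous_on_compose2[where f="\<lambda>s. u * g s",
            OF continuous_at_imp_continuous_on[OF ballI[OF D.isCont_char]] _ subset_UNIV])
         (intro continuous_intros g_cont)
    define \<mu> where "\<mu> = (LINT s:{0..t}|lborel. rate s)"
    define \<psi> where "\<psi> = (CLINT \<omega>|R. z (Lam0 \<omega>))"
    \<comment> \<open>The common exponent: the grid sums lead to the integral of
      \<open>z - 1\<close> against the rate, the right-hand sum to \<mu> * (\<psi> - 1).\<close>
    have "(CLINT s:{0..t}|lborel. rate s *\<^sub>R (z s - 1)) = of_real \<mu> * (CLINT \<omega>|R. z (Lam0 \<omega>) - 1)"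
      unfolding \<mu>_def
    proof (rule rate_integral_density[OF assms(4) t assms(9) Lam0_meas])
      show "norm (z s - 1) \<le> 2" for s
        using norm_triangle_ineq4[of "z s" 1] z_bound[of s] by simp
    qed (use z_meas in simp_all)
    also have "(CLINT \<omega>|R. z (Lam0 \<omega>) - 1) = \<psi> - 1"
      unfolding \<psi>_def
      by (subst Bochner_Integration.integral_diff)
         (auto intro!: R.integrable_const_bound[where B=1] z_bound measurable_compose[OF Lam0_meas z_meas] simp: R.prob_space)
    finally have exponent: "(CLINT s:{0..t}|lborel. rate s *\<^sub>R (z s - 1)) = of_real \<mu> * (\<psi> - 1)" .
    have "(\<lambda>n. CLINT \<omega>|P. iexp (u * S n \<omega>)) \<longlonglongrightarrow> (CLINT \<omega>|P. iexp (u * L \<omega>))"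
    proof (rule integral_dominated_convergence[where w="\<lambda>_. 1"])
      show "AE \<omega> in P. (\<lambda>n. iexp (u * S n \<omega>)) \<longlonglongrightarrow> iexp (u * L \<omega>)"
        by (intro AE_I2 tendsto_intros S_lim)
    qed (simp_all del: of_real_mult)
    moreover have "(\<lambda>n. CLINT \<omega>|P. iexp (u * S n \<omega>)) \<longlonglongrightarrow> exp (of_real \<mu> * (\<psi> - 1))"
    proof -
      \<comment> \<open>\<open>S n\<close> is a weighted sum of increments over the grid, with
        coefficients \<open>c i = g (grid t n i)\<close>.\<close>
      have "(CLINT \<omega>|P. iexp (u * S n \<omega>)) = exp (\<Sum>i<Suc n.
          of_real (LINT s:{grid t n i..grid t n (Suc i)}|lborel. rate s) * (z (grid t n i) - 1))" for n
        unfolding S_def z_def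
        by (rule poisson_process_increment_char[OF assms(1,2,5) pp iid indep])
           (auto simp: mono_def grid_mono[OF t])
      moreover have "(\<lambda>n. \<Sum>i<Suc n. of_real (LINT s:{grid t n i..grid t n (Suc i)}|lborel. rate s)
          * (z (grid t n i) - 1)) \<longlonglongrightarrow> (CLINT s:{0..t}|lborel. rate s *\<^sub>R (z s - 1))"
      proof (rule rate_integral_limit[OF assms(4) t])
        show "norm (z s - 1) \<le> 2" for s
          using norm_triangle_ineq4[of "z s" 1] z_bound[of s] by simp
      qed (intro continuous_intros z_cont)
      ultimately show ?thesis unfolding exponent by (simp only: tendsto_exp)
    qed
    ultimately have "(CLINT \<omega>|P. iexp (u * L \<omega>)) = exp (of_real \<mu> * (\<psi> - 1))"
      by (rule LIMSEQ_unique)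
    also have "\<dots> = (CLINT \<omega>|P. iexp (u * J \<omega>))"
      unfolding J_def \<mu>_def \<psi>_def z_def
      by (rule marked_poisson_char[OF assms(1-3,5) Lam0_meas g_meas pp iid assms(10) indep assms(11) t, symmetric])
    finally show ?thesis by (simp add: char_def integral_distr)
  qed
  then have "distr P borel L = distr P borel J"
    by (intro Levy_uniqueness real_distribution_distr) (auto intro: ext)
  then have "eq_in_distr P L P J"
    by (simp add: eq_in_distr_def)
  moreover have "L \<omega> = 0 \<and> J \<omega> = 0" if "t = 0" "\<omega> \<in> space P" for \<omega>
  proof -
    \<comment> \<open>At \<open>t = 0\<close> the sum is empty and the integral runs over a single
      point, a null set.\<close>
    have "N 0 \<omega> = 0" using pp that(2) by (simp add: poisson_process_def)
    then show ?thesis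
      using set_integral_Icc_Ioc[of 0 0 "\<lambda>s. (t - s) powr \<alpha> * M s \<omega>"]
      by (simp add: L_def J_def that(1) set_lebesgue_integral_def)
  qed
  ultimately show ?thesis
    unfolding L_def J_def g_def by blast
qed

end
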